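(* Let $A,B,S,T$ be finite sets and $\Gamma=A\times B\times S\times T$. For any $P\in C_q(\Gamma)$ we have $\xi_r^{\mathrm{q}}(P)\to\xi_\infty^{\mathrm{q}}(P)$ as $r\to\infty$.
   Context: Correlations. A correlation is $P=(P(a,b|s,t))\in\mathbb{R}^\Gamma$ with nonnegative entries and $\sum_{a,b}P(a,b|s,t)=1$ for all $(s,t)\in S\times T$. For $d\in\mathbb{N}$, $C_q^d(\Gamma)$ is the set of correlations $P(a,b|s,t)=\psi^*(E_s^a\otimes F_t^b)\psi$ with $\psi\in\mathbb{C}^d\otimes\mathbb{C}^d$ a unit vector and, for all $s\in S$, $t\in T$, $\{E_s^a\}_{a\in A}$, $\{F_t^b\}_{b\in B}$ families of $d\times d$ Hermitian positive semidefinite matrices summing to the identity; $C_q(\Gamma)=\bigcup_{d\in\mathbb{N}}C_q^d(\Gamma)$. Noncommutative polynomials. Let $\mathbf{x}=\{x_s^a:(a,s)\in A\times S\}$, $\mathbf{y}=\{y_t^b:(b,t)\in B\times T\}$, and let $z$ be one more symbol. For $m\in\mathbb{N}\cup\{\infty\}$, $\langle\mathbf{x},\mathbf{y},z\rangle_m$ is the set of words of length (degree) at most $m$ in these symbols and $\mathbb{R}\langle\mathbf{x},\mathbf{y},z\rangle_m$ is its real linear span, the noncommutative polynomials of degree at most $m$ (the subscript $\infty$ is omitted). The involution $*$ reverses words and fixes each symbol. For $r\in\mathbb{N}\cup\{\infty\}$, a linear functional $L\in\mathbb{R}\langle\mathbf{x},\mathbf{y},z\rangle_{2r}^*$ is symmetric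 if $L(w)=L(w^* )$ for all words $w$ of degree at most $2r$, and tracial if $L(ww')=L(w'w)$ for all words $w,w'$ with $\deg(ww')\le 2r$. Let $$\mathcal{G}=\{x_s^a:s\in S,a\in A\}\cup\{y_t^b:t\in T,b\in B\}\cup\{z\},$$ $$\mathcal{H}=\{z-z^2\}\cup\Big\{1-\sum_{a\in A}x_s^a:s\in S\Big\}\cup\Big\{1-\sum_{b\in B}y_t^b:t\in T\Big\}\cup\{x_s^ay_t^b-y_t^bx_s^a:(a,b,s,t)\in\Gamma\},$$ $$\mathcal{R}_r=\{zuzvz-zvzuz:u,v\in\langle\mathbf{x},\mathbf{y},z\rangle,\ \deg(zuzvz)\le 2r\}.$$ Let $\mathcal{M}_{2r}(\mathcal{G})$ be the convex cone generated by all $p^*gp$ with $p\in\mathbb{R}\langle\mathbf{x},\mathbf{y},z\rangle$, $g\in\mathcal{G}\cup\{1\}$, $\deg(p^*gp)\le 2r$, and let $\mathcal{I}_{2r}(\mathcal{H}\cup\mathcal{R}_r)=\{ph:p\in\mathbb{R}\langle\mathbf{x},\mathbf{y},z\rangle,\ h\in\mathcal{H}\cup\mathcal{R}_r,\ \deg(ph)\le 2r\}$. (For $r=\infty$ there are no degree restrictions.) For $r\in\mathbb{N}\cup\{\infty\}$, $\xi_r^{\mathrm{q}}(P)$ is the minimum of $L(1)$ over all tracial symmetric $L\in\mathbb{R}\langle\mathbf{x},\mathbf{y},z\rangle_{2r}^*$ such that $L(z)=1$, $L(x_s^ay_t^bz)=P(a,b|s,t)$ for all $(a,b,s,t)\in\Gamma$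 (a constraint to be omitted when $r=1$, since it then exceeds the degree bound), $L\ge0$ on $\mathcal{M}_{2r}(\mathcal{G})$, and $L=0$ on $\mathcal{I}_{2r}(\mathcal{H}\cup\mathcal{R}_r)$. *)

theory Defs
  imports
    "HOL-Analysis.Analysis"
    "HOL-Library.Poly_Mapping"
    "HOL-Library.Extended_Nat"
    "HOL-Library.Extended_Real"
    "Jordan_Normal_Form.Schur_Decomposition"
begin

section \<open>Quantum correlations\<close>

text \<open>An element of \<open>\<real>\<^sup>\<Gamma>\<close> with \<open>\<Gamma> = A \<times> B \<times> S \<times> T\<close> is a function on the tuple type; only its values
  on \<open>\<Gamma>\<close> are ever used.  \<open>P (a, b, s, t)\<close> stands for \<open>P(a,b|s,t)\<close>.\<close>

definition is_correlation ::
  "'a set \<Rightarrow> 'b set \<Rightarrow> 's set \<Rightarrow> 't set \<Rightarrow> ('a \<times> 'b \<times> 's \<times> 't \<Rightarrow> real) \<Rightarrow> bool" where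
  "is_correlation A B S T P \<longleftrightarrow>
     (\<forall>(a, b, s, t) \<in> A \<times> B \<times> S \<times> T. 0 \<le> P (a, b, s, t)) \<and>
     (\<forall>s\<in>S. \<forall>t\<in>T. (\<Sum>a\<in>A. \<Sum>b\<in>B. P (a, b, s, t)) = 1)"

definition hermitian_psd :: "nat \<Rightarrow> complex mat \<Rightarrow> bool" where
  "hermitian_psd d M \<longleftrightarrow> M \<in> carrier_mat d d \<and> mat_adjoint M = M \<and>
     (\<forall>v \<in> carrier_vec d. 0 \<le> (M *\<^sub>v v) \<bullet>c v)"

definition is_povm :: "nat \<Rightarrow> 'a set \<Rightarrow> ('a \<Rightarrow> complex mat) \<Rightarrow> bool" where
  "is_povm d A E \<longleftrightarrow> (\<forall>a\<in>A. hermitian_psd d (E a)) \<and>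
     mat d d (\<lambda>ij. \<Sum>a\<in>A. E a $$ ij) = 1\<^sub>m d"

text \<open>\<open>\<complex>\<^sup>d \<otimes> \<complex>\<^sup>d\<close> is identified with \<open>\<complex>\<^bsup>d * d\<^esup>\<close>, the basis vector \<open>e\<^sub>i \<otimes> e\<^sub>j\<close> having index \<open>i * d + j\<close>.\<close>

definition kronecker :: "complex mat \<Rightarrow> complex mat \<Rightarrow> complex mat" where
  "kronecker M N = mat (dim_row M * dim_row N) (dim_col M * dim_col N)
     (\<lambda>(i, j). M $$ (i div dim_row N, j div dim_col N) * N $$ (i mod dim_row N, j mod dim_col N))"

definition Cq_dim ::
  "nat \<Rightarrow> 'a set \<Rightarrow> 'b set \<Rightarrow> 's set \<Rightarrow> 't set \<Rightarrow> ('a \<times> 'b \<times> 's \<times> 't \<Rightarrow> real) set" where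
  "Cq_dim d A B S T = {P. is_correlation A B S T P \<and>
     (\<exists>\<psi> E F. \<psi> \<in> carrier_vec (d * d) \<and> \<psi> \<bullet>c \<psi> = 1 \<and>
        (\<forall>s\<in>S. is_povm d A (E s)) \<and> (\<forall>t\<in>T. is_povm d B (F t)) \<and>
        (\<forall>(a, b, s, t) \<in> A \<times> B \<times> S \<times> T.
           complex_of_real (P (a, b, s, t)) = (kronecker (E s a) (F t b) *\<^sub>v \<psi>) \<bullet>c \<psi>))}"

definition Cq ::
  "'a set \<Rightarrow> 'b set \<Rightarrow> 's set \<Rightarrow> 't set \<Rightarrow> ('a \<times> 'b \<times> 's \<times> 't \<Rightarrow> real) set" where
  "Cq A B S T = (\<Union>d. Cq_dim d A B S T)"


section \<open>Noncommutative polynomials\<close>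

text \<open>Words are lists of symbols.  With concatenation as (noncommutative) addition on lists, the
  convolution product on finitely supported functions \<open>'v list \<Rightarrow>\<^sub>0 real\<close> is the product of the free
  algebra.\<close>

instantiation list :: (type) monoid_add
begin

definition zero_list :: "'a list" where "zero_list = []"

definition plus_list :: "'a list \<Rightarrow> 'a list \<Rightarrow> 'a list" where "plus_list = (@)"

instance by standard (simp_all add: zero_list_def plus_list_def)

end

instantiation poly_mapping :: (type, real_vector) real_vector
begin

lift_definition scaleR_poly_mapping :: "real \<Rightarrow> ('a \<Rightarrow>\<^sub>0 'b) \<Rightarrow> 'a \<Rightarrow>\<^sub>0 'b"
  is "\<lambda>c f k. c *\<^sub>R f k"
  by (erule finite_subset[rotated]) auto

instance
  by standard
    (transfer; simp add: scaleR_add_right scaleR_add_left fun_eq_iff)+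

end

datatype ('a, 'b, 's, 't) symb = X 'a 's | Y 'b 't | Z

type_synonym ('a, 'b, 's, 't) word = "('a, 'b, 's, 't) symb list"

type_synonym ('a, 'b, 's, 't) ncpoly = "('a, 'b, 's, 't) word \<Rightarrow>\<^sub>0 real"

definition symbols :: "'a set \<Rightarrow> 'b set \<Rightarrow> 's set \<Rightarrow> 't set \<Rightarrow> ('a, 'b, 's, 't) symb set" where
  "symbols A B S T = {X a s |a s. a \<in> A \<and> s \<in> S} \<union> {Y b t |b t. b \<in> B \<and> t \<in> T} \<union> {Z}"

definition words :: "'a set \<Rightarrow> 'b set \<Rightarrow> 's set \<Rightarrow> 't set \<Rightarrow> enat \<Rightarrow> ('a, 'b, 's, 't) word set" where
  "words A B S T m = {w \<in> lists (symbols A B S T). enat (length w) \<le> m}"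

text \<open>Membership in \<open>ncpolys A B S T m\<close> is how a degree bound \<open>deg p \<le> m\<close> is expressed; the zero
  polynomial satisfies every bound.\<close>

definition ncpolys :: "'a set \<Rightarrow> 'b set \<Rightarrow> 's set \<Rightarrow> 't set \<Rightarrow> enat \<Rightarrow> ('a, 'b, 's, 't) ncpoly set" where
  "ncpolys A B S T m = {p. Poly_Mapping.keys p \<subseteq> words A B S T m}"

definition mon :: "('a, 'b, 's, 't) word \<Rightarrow> ('a, 'b, 's, 't) ncpoly" where
  "mon w = Poly_Mapping.single w 1"

abbreviation x_var :: "'a \<Rightarrow> 's \<Rightarrow> ('a, 'b, 's, 't) ncpoly" where "x_var a s \<equiv> mon [X a s]"
abbreviation y_var :: "'b \<Rightarrow> 't \<Rightarrow> ('a, 'b, 's, 't) ncpoly" where "y_var b t \<equiv> mon [Y b t]"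
abbreviation z_var :: "('a, 'b, 's, 't) ncpoly" where "z_var \<equiv> mon [Z]"

text \<open>The involution: the coefficient of \<open>w\<close> in \<open>star p\<close> is that of \<open>rev w\<close> in \<open>p\<close>.\<close>

definition star :: "('a, 'b, 's, 't) ncpoly \<Rightarrow> ('a, 'b, 's, 't) ncpoly" where
  "star p = Poly_Mapping.map_key rev p"

definition linear_on :: "'v::real_vector set \<Rightarrow> ('v \<Rightarrow> real) \<Rightarrow> bool" where
  "linear_on V L \<longleftrightarrow> (\<forall>p\<in>V. \<forall>q\<in>V. L (p + q) = L p + L q) \<and> (\<forall>c. \<forall>p\<in>V. L (c *\<^sub>R p) = c * L p)"

definition symmetric_on :: "'a set \<Rightarrow> 'b set \<Rightarrow> 's set \<Rightarrow> 't set \<Rightarrow> enat \<Rightarrow>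
    (('a, 'b, 's, 't) ncpoly \<Rightarrow> real) \<Rightarrow> bool" where
  "symmetric_on A B S T m L \<longleftrightarrow> (\<forall>w \<in> words A B S T m. L (mon w) = L (star (mon w)))"

definition tracial_on :: "'a set \<Rightarrow> 'b set \<Rightarrow> 's set \<Rightarrow> 't set \<Rightarrow> enat \<Rightarrow>
    (('a, 'b, 's, 't) ncpoly \<Rightarrow> real) \<Rightarrow> bool" where
  "tracial_on A B S T m L \<longleftrightarrow>
     (\<forall>w w'. w @ w' \<in> words A B S T m \<longrightarrow> L (mon (w @ w')) = L (mon (w' @ w)))"


section \<open>The hierarchy\<close>

definition gens :: "'a set \<Rightarrow> 'b set \<Rightarrow> 's set \<Rightarrow> 't set \<Rightarrow> ('a, 'b, 's, 't) ncpoly set" where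
  "gens A B S T = {x_var a s |a s. s \<in> S \<and> a \<in> A} \<union> {y_var b t |b t. t \<in> T \<and> b \<in> B} \<union> {z_var}"

definition hrels :: "'a set \<Rightarrow> 'b set \<Rightarrow> 's set \<Rightarrow> 't set \<Rightarrow> ('a, 'b, 's, 't) ncpoly set" where
  "hrels A B S T =
     {z_var - z_var ^ 2} \<union>
     {1 - (\<Sum>a\<in>A. x_var a s) |s. s \<in> S} \<union>
     {1 - (\<Sum>b\<in>B. y_var b t) |t. t \<in> T} \<union>
     {x_var a s * y_var b t - y_var b t * x_var a s |a b s t. (a, b, s, t) \<in> A \<times> B \<times> S \<times> T}"

definition rrels :: "'a set \<Rightarrow> 'b set \<Rightarrow> 's set \<Rightarrow> 't set \<Rightarrow> enat \<Rightarrow> ('a, 'b, 's, 't) ncpoly set" where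
  "rrels A B S T r =
     {z_var * mon u * z_var * mon v * z_var - z_var * mon v * z_var * mon u * z_var |u v.
        u \<in> words A B S T \<infinity> \<and> v \<in> words A B S T \<infinity> \<and>
        z_var * mon u * z_var * mon v * z_var \<in> ncpolys A B S T (2 * r)}"

text \<open>In \<open>quad_module\<close> and \<open>trunc_ideal\<close> the argument \<open>m\<close> is the degree bound \<open>2r\<close>.\<close>

definition quad_module :: "'a set \<Rightarrow> 'b set \<Rightarrow> 's set \<Rightarrow> 't set \<Rightarrow> enat \<Rightarrow>
    ('a, 'b, 's, 't) ncpoly set \<Rightarrow> ('a, 'b, 's, 't) ncpoly set" where
  "quad_module A B S T m G = convex_cone hull
     {star p * g * p |p g. p \<in> ncpolys A B S T \<infinity> \<and> g \<in> G \<union> {1} \<and>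
        star p * g * p \<in> ncpolys A B S T m}"

definition trunc_ideal :: "'a set \<Rightarrow> 'b set \<Rightarrow> 's set \<Rightarrow> 't set \<Rightarrow> enat \<Rightarrow>
    ('a, 'b, 's, 't) ncpoly set \<Rightarrow> ('a, 'b, 's, 't) ncpoly set" where
  "trunc_ideal A B S T m H =
     {p * h |p h. p \<in> ncpolys A B S T \<infinity> \<and> h \<in> H \<and> p * h \<in> ncpolys A B S T m}"

text \<open>A functional on the polynomials of degree at most \<open>2r\<close> is a function on all polynomials of
  which only the values on that subspace are constrained.\<close>

definition xi_feasible :: "'a set \<Rightarrow> 'b set \<Rightarrow> 's set \<Rightarrow> 't set \<Rightarrow> ('a \<times> 'b \<times> 's \<times> 't \<Rightarrow> real) \<Rightarrow>
    enat \<Rightarrow> (('a, 'b, 's, 't) ncpoly \<Rightarrow> real) set" where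
  "xi_feasible A B S T P r = {L.
     linear_on (ncpolys A B S T (2 * r)) L \<and>
     symmetric_on A B S T (2 * r) L \<and>
     tracial_on A B S T (2 * r) L \<and>
     L z_var = 1 \<and>
     (2 \<le> r \<longrightarrow> (\<forall>(a, b, s, t) \<in> A \<times> B \<times> S \<times> T.
        L (x_var a s * y_var b t * z_var) = P (a, b, s, t))) \<and>
     (\<forall>p \<in> quad_module A B S T (2 * r) (gens A B S T). 0 \<le> L p) \<and>
     (\<forall>p \<in> trunc_ideal A B S T (2 * r) (hrels A B S T \<union> rrels A B S T r). L p = 0)}"

text \<open>The optimal value is the infimum in the extended reals: it equals the minimum whenever that is
  attained, and it is \<open>\<infinity>\<close> for an infeasible problem.\<close>

definition xi_q :: "'a set \<Rightarrow> 'b set \<Rightarrow> 's set \<Rightarrow> 't set \<Rightarrow> ('a \<times> 'b \<times> 's \<times> 't \<Rightarrow> real) \<Rightarrow>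
    enat \<Rightarrow> ereal" where
  "xi_q A B S T P r = (INF L \<in> xi_feasible A B S T P r. ereal (L 1))"

end

theory Submission
  imports Defs "HOL-Complex_Analysis.Great_Picard"
begin

text \<open>The feasible sets are nested, so \<open>\<xi>\<^sub>r\<close> increases with \<open>r\<close>.  If it stays below a real \<open>c\<close>, choose
  feasible functionals \<open>L\<^sub>r\<close> with \<open>L\<^sub>r(1) \<le> c\<close>.  Modulo the relations every symbol lies between \<open>0\<close>
  and \<open>1\<close>; by traciality this gives \<open>L\<^sub>r(w\<^sup>* w) \<le> L\<^sub>r(1)\<close>, hence \<open>\<bar>L\<^sub>r(w)\<bar> \<le> c\<close>, once \<open>r\<close> exceeds the
  length of \<open>w\<close>.  As there are only countably many words, a subsequence converges pointwise, and its
  limit is feasible for \<open>r = \<infinity>\<close> because every constraint involves only finitely many words.\<close>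

section \<open>Degree bounds and arithmetic of noncommutative polynomials\<close>

lemma words_enat_iff:
  "u \<in> words A B S T (2 * enat r) \<longleftrightarrow> u \<in> lists (symbols A B S T) \<and> length u \<le> 2 * r"
  by (simp add: words_def numeral_eq_enat)

lemma words_infinity: "words A B S T \<infinity> = lists (symbols A B S T)"
  by (simp add: words_def)

lemma ncpolys_mono: "m \<le> m' \<Longrightarrow> ncpolys A B S T m \<subseteq> ncpolys A B S T m'"
  unfolding ncpolys_def words_def using order_trans[of _ m m'] by blast

lemma mon_in_ncpolys_iff [simp]: "mon w \<in> ncpolys A B S T m \<longleftrightarrow> w \<in> words A B S T m"
  by (simp add: ncpolys_def mon_def)

lemma add_in_ncpolys:
  "p \<in> ncpolys A B S T m \<Longrightarrow> q \<in> ncpolys A B S T m \<Longrightarrow> p + q \<in> ncpolys A B S T m"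
  unfolding ncpolys_def using keys_add[of p q] by blast

lemma lookup_scaleR [simp]: "Poly_Mapping.lookup (c *\<^sub>R p) k = c *\<^sub>R Poly_Mapping.lookup p k"
  by transfer simp

lemma keys_scaleR_subset: "Poly_Mapping.keys (c *\<^sub>R p) \<subseteq> Poly_Mapping.keys p"
  by (auto simp: in_keys_iff)

lemma scaleR_in_ncpolys: "p \<in> ncpolys A B S T m \<Longrightarrow> c *\<^sub>R p \<in> ncpolys A B S T m"
  unfolding ncpolys_def using keys_scaleR_subset[of c p] by blast

lemma zero_in_ncpolys [simp]: "0 \<in> ncpolys A B S T m"
  by (simp add: ncpolys_def)

lemma uminus_in_ncpolys: "p \<in> ncpolys A B S T m \<Longrightarrow> - p \<in> ncpolys A B S T m"
  using scaleR_in_ncpolys[of p A B S T m "-1"] by simp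

lemma diff_in_ncpolys:
  "p \<in> ncpolys A B S T m \<Longrightarrow> q \<in> ncpolys A B S T m \<Longrightarrow> p - q \<in> ncpolys A B S T m"
  using add_in_ncpolys[OF _ uminus_in_ncpolys] by fastforce

lemma sum_in_ncpolys:
  "(\<And>i. i \<in> I \<Longrightarrow> f i \<in> ncpolys A B S T m) \<Longrightarrow> sum f I \<in> ncpolys A B S T m"
  by (induction I rule: infinite_finite_induct) (auto intro: add_in_ncpolys)

lemma mon_mult [simp]: "mon u * mon v = mon (u @ v)"
  by (simp add: mon_def mult_single plus_list_def)

lemma mon_Nil: "mon [] = 1"
  by (metis mon_def single_one zero_list_def)

lemma inj_rev: "inj rev"
  by (simp add: inj_def)

lemma star_mon [simp]: "star (mon w) = mon (rev w)"
proof -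
  \<comment> \<open>\<open>map_key_single\<close> expects a key of the form \<open>rev k\<close>,
    which \<open>k = rev w\<close> provides.\<close>
  have "Poly_Mapping.map_key rev (Poly_Mapping.single (rev (rev w)) 1) = Poly_Mapping.single (rev w) 1"
    by (rule map_key_single) (rule inj_rev)
  then show ?thesis by (simp add: star_def mon_def)
qed

lemma star_add: "star (p + q) = star p + star q"
  by (simp add: star_def map_key_plus[OF inj_rev])

lemma star_scaleR: "star (c *\<^sub>R p) = c *\<^sub>R star p"
  by (rule poly_mapping_eqI) (simp add: star_def map_key.rep_eq[OF inj_rev])

lemma scaleR_mon: "c *\<^sub>R mon w = Poly_Mapping.single w c"
  by (rule poly_mapping_eqI) (simp add: mon_def lookup_single when_def)

lemma scaleR_mon_mult [simp]:
  "(c *\<^sub>R mon u) * mon v = c *\<^sub>R mon (u @ v)"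
  "mon u * (c *\<^sub>R mon v) = c *\<^sub>R mon (u @ v)"
  "(c *\<^sub>R mon u) * (d *\<^sub>R mon v) = (c * d) *\<^sub>R mon (u @ v)"
  unfolding scaleR_mon by (simp_all add: mon_def mult_single plus_list_def)

text \<open>The support is finite, so some level contains all of it. This is what reduces a
  constraint at level \<open>\<infinity>\<close> to eventually all finite levels.\<close>

lemma ncpolys_infinity_degree:
  assumes "p \<in> ncpolys A B S T \<infinity>"
  shows "\<exists>N. \<forall>n\<ge>N. p \<in> ncpolys A B S T (2 * enat n)"
proof -
  define N where "N = Max (insert 0 (length ` Poly_Mapping.keys p))"
  have "length w \<le> N" if "w \<in> Poly_Mapping.keys p" for w
    unfolding N_def using that by (intro Max_ge) auto
  then have "length w \<le> 2 * n" if "w \<in> Poly_Mapping.keys p" "n \<ge> N" for w n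
    using that by fastforce
  then show ?thesis
    using assms unfolding ncpolys_def by (auto simp: words_enat_iff words_infinity subset_iff)
qed

lemma linear_on_diff:
  assumes "linear_on (ncpolys A B S T m) L" "p \<in> ncpolys A B S T m" "q \<in> ncpolys A B S T m"
  shows "L (p - q) = L p - L q"
proof -
  have "L (p + - q) = L p + L (- q)"
    using assms uminus_in_ncpolys[OF assms(3)] unfolding linear_on_def by blast
  moreover have "L ((-1) *\<^sub>R q) = (-1) * L q"
    using assms unfolding linear_on_def by blast
  ultimately show ?thesis by simp
qed

lemma linear_on_sum:
  assumes "linear_on (ncpolys A B S T m) L" "\<And>i. i \<in> I \<Longrightarrow> f i \<in> ncpolys A B S T m"
  shows "L (sum f I) = (\<Sum>i\<in>I. L (f i))"
proof -
  have "L 0 = 0"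
    using linear_on_diff[OF assms(1) zero_in_ncpolys zero_in_ncpolys] by simp
  then show ?thesis using assms(2)
  proof (induction I rule: infinite_finite_induct)
    case (insert i I)
    then show ?case
      using assms(1) by (simp add: linear_on_def sum_in_ncpolys)
  qed auto
qed

text \<open>Reduces convergence of functionals on polynomials to convergence on single
  words.\<close>

lemma linear_on_ncpolys_expand:
  assumes L: "linear_on (ncpolys A B S T m) L" and p: "p \<in> ncpolys A B S T m"
  shows "L p = (\<Sum>w\<in>Poly_Mapping.keys p. Poly_Mapping.lookup p w * L (mon w))"
proof -
  have e: "(\<Sum>w\<in>Poly_Mapping.keys p. Poly_Mapping.lookup p w *\<^sub>R mon w) = p"
    by (rule poly_mapping_eqI)
      (simp add: lookup_sum mon_def lookup_single when_def in_keys_iff if_distrib cong: if_cong)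
  have w: "mon w \<in> ncpolys A B S T m" if "w \<in> Poly_Mapping.keys p" for w
    using p that unfolding mon_in_ncpolys_iff by (auto simp: ncpolys_def)
  have "L (\<Sum>w\<in>Poly_Mapping.keys p. Poly_Mapping.lookup p w *\<^sub>R mon w)
      = (\<Sum>w\<in>Poly_Mapping.keys p. L (Poly_Mapping.lookup p w *\<^sub>R mon w))"
    using w by (intro linear_on_sum[OF L] scaleR_in_ncpolys)
  also have "\<dots> = (\<Sum>w\<in>Poly_Mapping.keys p. Poly_Mapping.lookup p w * L (mon w))"
    using w L by (intro sum.cong refl) (simp add: linear_on_def)
  finally show ?thesis
    by (simp only: e)
qed

section \<open>Monotonicity\<close>

lemma quad_module_mono:
  "m \<le> m' \<Longrightarrow> quad_module A B S T m G \<subseteq> quad_module A B S T m' G"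
  unfolding quad_module_def
  by (rule hull_mono) (use ncpolys_mono[of m m' A B S T] in blast)

lemma rrels_mono: "r \<le> r' \<Longrightarrow> rrels A B S T r \<subseteq> rrels A B S T r'"
  unfolding rrels_def using ncpolys_mono[OF mult_left_mono[of r r' 2], of A B S T]
  by (simp del: mon_mult mon_in_ncpolys_iff) blast

lemma trunc_ideal_mono:
  "m \<le> m' \<Longrightarrow> H \<subseteq> H' \<Longrightarrow> trunc_ideal A B S T m H \<subseteq> trunc_ideal A B S T m' H'"
  unfolding trunc_ideal_def using ncpolys_mono[of m m' A B S T] by blast

text \<open>A functional is a function on all polynomials whatever the level, so the same
  \<open>L\<close> serves both levels, and each constraint at level \<open>r\<close> is among those
  at level \<open>r'\<close>.\<close>

lemma xi_feasible_antimono: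
  assumes "r \<le> r'"
  shows "xi_feasible A B S T P r' \<subseteq> xi_feasible A B S T P r"
proof
  fix L assume L: "L \<in> xi_feasible A B S T P r'"
  have le: "2 * r \<le> 2 * r'"
    using assms by (simp add: mult_left_mono)
  have W: "words A B S T (2 * r) \<subseteq> words A B S T (2 * r')"
    using le unfolding words_def by (auto intro: order_trans)
  have "2 \<le> r \<Longrightarrow> 2 \<le> r'"
    using assms by (rule order_trans[rotated])
  moreover have "trunc_ideal A B S T (2 * r) (hrels A B S T \<union> rrels A B S T r)
      \<subseteq> trunc_ideal A B S T (2 * r') (hrels A B S T \<union> rrels A B S T r')"
    by (intro trunc_ideal_mono le Un_mono rrels_mono assms order_refl)
  ultimately show "L \<in> xi_feasible A B S T P r"
    using L ncpolys_mono[OF le, of A B S T] W quad_module_mono[OF le, of A B S T "gens A B S T"]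
    unfolding xi_feasible_def linear_on_def symmetric_on_def tracial_on_def
    by (intro CollectI conjI) blast+
qed

lemma xi_q_mono: "r \<le> r' \<Longrightarrow> xi_q A B S T P r \<le> xi_q A B S T P r'"
  unfolding xi_q_def by (rule INF_superset_mono) (auto dest: xi_feasible_antimono)

section \<open>Boundedness of feasible functionals\<close>

text \<open>Positivity of \<open>L\<close> on \<open>star p * mon h * p\<close> with
  \<open>p = mon u + c *\<^sub>R mon v\<close>. The empty \<open>h\<close> stands for the weight
  \<open>1\<close>, a single letter for an element of \<open>gens\<close>.\<close>

lemma feasible_quadratic:
  assumes L: "L \<in> xi_feasible A B S T P (enat r)"
    and u: "u \<in> lists (symbols A B S T)" "2 * length u + length h \<le> 2 * r"
    and v: "v \<in> lists (symbols A B S T)" "2 * length v + length h \<le> 2 * r"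
    and h: "h = [] \<or> (\<exists>\<sigma>\<in>symbols A B S T. h = [\<sigma>])"
  shows "0 \<le> L (mon (rev u @ h @ u)) + 2 * c * L (mon (rev u @ h @ v))
              + c\<^sup>2 * L (mon (rev v @ h @ v))"
proof -
  let ?V = "ncpolys A B S T (2 * enat r)"
  have hs: "h \<in> lists (symbols A B S T)" "rev h = h"
    using h by auto
  have rl: "rev x \<in> lists (symbols A B S T)" if "x \<in> lists (symbols A B S T)" for x
    using that by (simp add: lists_eq_set)
  have g: "mon h \<in> gens A B S T \<union> {1}"
    using h by (auto simp: gens_def symbols_def mon_Nil)
  \<comment> \<open>The length of a mixed word is the average of the two lengths bounded by
    assumption.\<close>
  have in_words: "rev x @ h @ y \<in> words A B S T (2 * enat r)" if "x \<in> {u, v}" "y \<in> {u, v}" for x y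
    using that u v hs by (auto simp: words_enat_iff rl)
  let ?p = "mon u + c *\<^sub>R mon v"
  let ?q = "mon (rev u @ h @ u) + c *\<^sub>R mon (rev u @ h @ v)
     + (c *\<^sub>R mon (rev v @ h @ u) + (c\<^sup>2) *\<^sub>R mon (rev v @ h @ v))"
  have q: "star ?p * mon h * ?p = ?q"
    by (simp add: star_add star_scaleR algebra_simps power2_eq_square)
  have "star ?p * mon h * ?p \<in> ?V"
    unfolding q by (intro add_in_ncpolys scaleR_in_ncpolys) (auto simp: in_words)
  moreover have "?p \<in> ncpolys A B S T \<infinity>"
    using u v by (intro add_in_ncpolys scaleR_in_ncpolys) (auto simp: words_infinity)
  ultimately have "?q \<in> quad_module A B S T (2 * enat r) (gens A B S T)"
    unfolding quad_module_def q[symmetric] using g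
    by (intro hull_inc CollectI exI[of _ ?p] exI[of _ "mon h"] conjI refl)
  then have "0 \<le> L ?q"
    using L by (auto simp: xi_feasible_def)
  also have "L ?q = L (mon (rev u @ h @ u)) + c * L (mon (rev u @ h @ v))
      + (c * L (mon (rev v @ h @ u)) + c\<^sup>2 * L (mon (rev v @ h @ v)))"
  proof -
    have add: "L (p + q) = L p + L q" if "p \<in> ?V" "q \<in> ?V" for p q
      using L that by (simp add: xi_feasible_def linear_on_def)
    have sc: "L (c *\<^sub>R p) = c * L p" if "p \<in> ?V" for c p
      using L that by (simp add: xi_feasible_def linear_on_def)
    show ?thesis
      by (simp add: add sc in_words add_in_ncpolys scaleR_in_ncpolys)
  qed
  \<comment> \<open>Both cross terms agree by symmetry of \<open>L\<close>, since
    \<open>rev h = h\<close>.\<close>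
  also have "L (mon (rev v @ h @ u)) = L (mon (rev u @ h @ v))"
    using L in_words[of v u] hs(2) by (simp add: xi_feasible_def symmetric_on_def)
  finally show ?thesis
    by simp
qed

lemma feasible_nonneg:
  assumes "L \<in> xi_feasible A B S T P (enat r)" "u \<in> lists (symbols A B S T)"
    "2 * length u + length h \<le> 2 * r" "h = [] \<or> (\<exists>\<sigma>\<in>symbols A B S T. h = [\<sigma>])"
  shows "0 \<le> L (mon (rev u @ h @ u))"
  using feasible_quadratic[OF assms(1-3) assms(2-4), of 0] by simp

lemma feasible_tracial:
  assumes "L \<in> xi_feasible A B S T P (enat r)" "u @ v \<in> lists (symbols A B S T)"
    "length u + length v \<le> 2 * r"
  shows "L (mon (u @ v)) = L (mon (v @ u))"
  using assms unfolding xi_feasible_def tracial_on_def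
  by (simp add: words_enat_iff)

lemma feasible_relation:
  assumes L: "L \<in> xi_feasible A B S T P (enat r)"
    and u: "u \<in> lists (symbols A B S T)" and h: "h \<in> hrels A B S T"
    and d: "mon u * h \<in> ncpolys A B S T (2 * enat r)"
  shows "L (mon u * h) = 0"
proof -
  have "mon u * h \<in> trunc_ideal A B S T (2 * enat r) (hrels A B S T \<union> rrels A B S T (enat r))"
    unfolding trunc_ideal_def using u h d
    by (intro CollectI exI[of _ "mon u"] exI[of _ h] conjI refl) (simp_all add: words_infinity)
  then show ?thesis
    using L by (simp add: xi_feasible_def)
qed

lemma feasible_linear:
  assumes "L \<in> xi_feasible A B S T P r"
  shows "linear_on (ncpolys A B S T (2 * r)) L"
  using assms by (simp add: xi_feasible_def)

text \<open>The truncated ideal only allows left multiples \<open>p * h\<close>, so relations are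
  first obtained at the right end of a word; traciality later carries them elsewhere.\<close>

lemma feasible_z:
  assumes L: "L \<in> xi_feasible A B S T P (enat r)"
    and u: "u \<in> lists (symbols A B S T)" "length u + 2 \<le> 2 * r"
  shows "L (mon (u @ [Z, Z])) = L (mon (u @ [Z]))"
proof -
  have Z: "Z \<in> symbols A B S T"
    by (simp add: symbols_def)
  have e: "mon u * (z_var - z_var ^ 2) = mon (u @ [Z]) - mon (u @ [Z, Z])"
    by (simp add: algebra_simps power2_eq_square)
  have w: "u @ [Z] \<in> words A B S T (2 * enat r)" "u @ [Z, Z] \<in> words A B S T (2 * enat r)"
    using u Z by (auto simp: words_enat_iff)
  have "L (mon u * (z_var - z_var ^ 2)) = 0"
    using w by (intro feasible_relation[OF L u(1)])
      (auto simp: hrels_def e intro!: diff_in_ncpolys)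
  then show ?thesis
    unfolding e using w by (simp add: linear_on_diff[OF feasible_linear[OF L]])
qed

text \<open>Abstracting the letters as \<open>f\<close> treats the relations for the
  \<open>X\<close> and the \<open>Y\<close> letters at once.\<close>

lemma feasible_povm:
  assumes L: "L \<in> xi_feasible A B S T P (enat r)"
    and u: "u \<in> lists (symbols A B S T)" "length u + 1 \<le> 2 * r"
    and h: "1 - (\<Sum>i\<in>I. mon [f i]) \<in> hrels A B S T"
    and f: "\<And>i. i \<in> I \<Longrightarrow> f i \<in> symbols A B S T"
  shows "L (mon u) = (\<Sum>i\<in>I. L (mon (u @ [f i])))"
proof -
  have e: "mon u * (1 - (\<Sum>i\<in>I. mon [f i])) = mon u - (\<Sum>i\<in>I. mon (u @ [f i]))"
    by (simp add: algebra_simps sum_distrib_left)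
  have w: "u \<in> words A B S T (2 * enat r)" "\<And>i. i \<in> I \<Longrightarrow> u @ [f i] \<in> words A B S T (2 * enat r)"
    using u f by (auto simp: words_enat_iff)
  have s: "(\<Sum>i\<in>I. mon (u @ [f i])) \<in> ncpolys A B S T (2 * enat r)"
    using w by (intro sum_in_ncpolys) auto
  have "L (mon u * (1 - (\<Sum>i\<in>I. mon [f i]))) = 0"
    using w s by (intro feasible_relation[OF L u(1) h]) (auto simp: e intro!: diff_in_ncpolys)
  then show ?thesis
    unfolding e using w s
    by (simp add: linear_on_diff[OF feasible_linear[OF L]] linear_on_sum[OF feasible_linear[OF L]])
qed

text \<open>A cyclic rotation moves the gap between \<open>rev v\<close> and \<open>v\<close> to the
  right end. There the empty word expands into the sum over a whole measurement, whose other terms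
  are nonnegative. For \<open>Z\<close>, idempotence makes \<open>1 - Z\<close> a square.\<close>

lemma feasible_letter_le:
  assumes fin: "finite A" "finite B" and L: "L \<in> xi_feasible A B S T P (enat r)"
    and \<sigma>: "\<sigma> \<in> symbols A B S T" and v: "v \<in> lists (symbols A B S T)" "length v + 1 \<le> r"
  shows "L (mon (rev v @ [\<sigma>] @ v)) \<le> L (mon (rev v @ v))"
proof -
  have rv: "rev v \<in> lists (symbols A B S T)"
    using v by (simp add: lists_eq_set)
  have povm: ?thesis
    if h: "1 - (\<Sum>i\<in>I. mon [f i]) \<in> hrels A B S T" and "finite I"
      and f: "\<And>i. i \<in> I \<Longrightarrow> f i \<in> symbols A B S T" and i: "i \<in> I" "f i = \<sigma>" for I f i
  proof -
    have tr: "L (mon (v @ rev v @ [f j])) = L (mon (rev v @ [f j] @ v))" if "j \<in> I" for j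
      using feasible_tracial[OF L, of v "rev v @ [f j]"] f[OF that] v rv by auto
    have "L (mon (rev v @ v)) = L (mon (v @ rev v))"
      using feasible_tracial[OF L, of "rev v" v] v rv by auto
    also have "\<dots> = (\<Sum>j\<in>I. L (mon ((v @ rev v) @ [f j])))"
      using v rv by (intro feasible_povm[OF L _ _ h f]) auto
    also have "\<dots> = (\<Sum>j\<in>I. L (mon (rev v @ [f j] @ v)))"
      using tr by (intro sum.cong) auto
    \<comment> \<open>All summands are nonnegative because the letters are weights in
      \<open>gens\<close>.\<close>
    also have "\<dots> \<ge> L (mon (rev v @ [f i] @ v))"
      using f v \<open>finite I\<close> i(1)
      by (intro member_le_sum[of i I "\<lambda>j. L (mon (rev v @ [f j] @ v))"] feasible_nonneg[OF L]) auto
    finally show ?thesis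
      using i by simp
  qed
  consider (X) a s where "\<sigma> = X a s" "a \<in> A" "s \<in> S" | (Y) b t where "\<sigma> = Y b t" "b \<in> B" "t \<in> T"
    | (Z) "\<sigma> = Z"
    using \<sigma> by (auto simp: symbols_def)
  then show ?thesis
  proof cases
    case X
    then show ?thesis
      using fin by (intro povm[of "\<lambda>a. X a s" A a]) (auto simp: hrels_def symbols_def)
  next
    case Y
    then show ?thesis
      using fin by (intro povm[of "\<lambda>b. Y b t" B b]) (auto simp: hrels_def symbols_def)
  next
    case Z
    have "L (mon (rev v @ [Z, Z] @ v)) = L (mon (v @ rev v @ [Z, Z]))"
      using feasible_tracial[OF L, of v "rev v @ [Z, Z]"] v rv \<sigma> Z by auto
    also have "\<dots> = L (mon (v @ rev v @ [Z]))"
      using feasible_z[OF L, of "v @ rev v"] v rv by auto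
    also have "\<dots> = L (mon (rev v @ [Z] @ v))"
      using feasible_tracial[OF L, of v "rev v @ [Z]"] v rv \<sigma> Z by auto
    finally have zz: "L (mon (rev v @ [Z, Z] @ v)) = L (mon (rev v @ [Z] @ v))" .
    show ?thesis
      \<comment> \<open>With \<open>p = v - Z v\<close> this reads
        \<open>0 \<le> L (v* v) - 2 L (v* Z v) + L (v* Z Z v)\<close>, and the last two terms
        combine by \<open>zz\<close>.\<close>
      using feasible_quadratic[OF L, of v "[]" "Z # v" "-1"] v \<sigma> Z zz by simp
  qed
qed

text \<open>From \<open>0 \<le> L (v\<^sup>* (1 - \<sigma>) \<sigma> (1 - \<sigma>) v)\<close> and \<open>L (v\<^sup>* \<sigma>\<^sup>3 v) \<le> L (v\<^sup>* \<sigma>\<^sup>2 v)\<close>.\<close>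

lemma feasible_letter_sq_le:
  assumes fin: "finite A" "finite B" and L: "L \<in> xi_feasible A B S T P (enat r)"
    and \<sigma>: "\<sigma> \<in> symbols A B S T" and v: "v \<in> lists (symbols A B S T)" "length v + 2 \<le> r"
  shows "L (mon (rev v @ [\<sigma>, \<sigma>] @ v)) \<le> L (mon (rev v @ v))"
  using feasible_quadratic[OF L, of v "[\<sigma>]" "\<sigma> # v" "-1"]
    feasible_letter_le[OF fin L \<sigma>, of "\<sigma> # v"] feasible_letter_le[OF fin L \<sigma>, of v] v \<sigma>
  by simp

text \<open>Each induction step removes the two equal letters in the middle of
  \<open>rev w @ w\<close>, until the empty word is left.\<close>

lemma feasible_square_le:
  assumes fin: "finite A" "finite B" and L: "L \<in> xi_feasible A B S T P (enat r)"
    and w: "w \<in> lists (symbols A B S T)" "length w + 1 \<le> r"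
  shows "L (mon (rev w @ w)) \<le> L 1"
  using w
proof (induction w)
  case (Cons \<sigma> v)
  then show ?case
    using feasible_letter_sq_le[OF fin L, of \<sigma> v] by fastforce
qed (simp add: mon_Nil)

text \<open>A Cauchy-Schwarz type estimate: positivity on the squares of \<open>1 + w\<close> and
  \<open>1 - w\<close> gives \<open>2 * \<bar>L w\<bar> \<le> L 1 + L (w* w)\<close>. The bound
  depends on \<open>r\<close> only through \<open>L 1\<close>.\<close>

lemma feasible_bounded:
  assumes fin: "finite A" "finite B" and L: "L \<in> xi_feasible A B S T P (enat r)"
    and w: "w \<in> lists (symbols A B S T)" "length w + 1 \<le> r"
  shows "\<bar>L (mon w)\<bar> \<le> L 1"
proof -
  have "0 \<le> L 1 + 2 * c * L (mon w) + c\<^sup>2 * L (mon (rev w @ w))" for c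
    using feasible_quadratic[OF L, of "[]" "[]" w c] w by (simp add: mon_Nil)
  from this[of 1] this[of "-1"] show ?thesis
    using feasible_square_le[OF fin L w] by simp
qed

section \<open>Limits of feasible functionals\<close>

text \<open>A fixed polynomial eventually obeys the degree bound of \<open>M n\<close>, so each of
  its constraints eventually holds along the sequence; equalities and weak inequalities pass to the
  limit.\<close>

lemma feasible_limit:
  assumes k: "strict_mono (k :: nat \<Rightarrow> nat)"
    and M: "\<And>n. M n \<in> xi_feasible A B S T P (enat (k n))"
    and lim: "\<And>p. p \<in> ncpolys A B S T \<infinity> \<Longrightarrow> (\<lambda>n. M n p) \<longlonglongrightarrow> L p"
  shows "L \<in> xi_feasible A B S T P \<infinity>"
proof -
  have ev: "\<forall>\<^sub>F n in sequentially. p \<in> ncpolys A B S T (2 * enat (k n))"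
    if p: "p \<in> ncpolys A B S T \<infinity>" for p
  proof -
    obtain N where N: "\<forall>n\<ge>N. p \<in> ncpolys A B S T (2 * enat n)"
      using ncpolys_infinity_degree[OF p] by blast
    then show ?thesis
      using seq_suble[OF k] by (intro eventually_sequentiallyI[of N]) (meson order_trans)
  qed
  have ev_mon: "\<forall>\<^sub>F n in sequentially. w \<in> words A B S T (2 * enat (k n))"
    if "w \<in> words A B S T \<infinity>" for w
    using ev[of "mon w"] that by simp
  have eqI: "L p = c"
    if "p \<in> ncpolys A B S T \<infinity>" "\<forall>\<^sub>F n in sequentially. M n p = f n" "f \<longlonglongrightarrow> c" for p f c
    using LIMSEQ_unique[OF lim[OF that(1)]] that(3) tendsto_cong[OF that(2)] by blast
  have two_times_infinity: "2 * \<infinity> = (\<infinity> :: enat)"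
    by (simp add: imult_is_infinity)
  have Z: "Z \<in> symbols A B S T"
    by (simp add: symbols_def)
  have "linear_on (ncpolys A B S T \<infinity>) L"
    unfolding linear_on_def
  proof (intro conjI ballI allI)
    fix p q assume pq: "p \<in> ncpolys A B S T \<infinity>" "q \<in> ncpolys A B S T \<infinity>"
    show "L (p + q) = L p + L q"
    proof (rule eqI[OF add_in_ncpolys[OF pq] _ tendsto_add[OF lim[OF pq(1)] lim[OF pq(2)]]])
      show "\<forall>\<^sub>F n in sequentially. M n (p + q) = M n p + M n q"
        using ev[OF pq(1)] ev[OF pq(2)]
        by eventually_elim (use feasible_linear[OF M] in \<open>simp add: linear_on_def\<close>)
    qed
  next
    fix c p assume p: "p \<in> ncpolys A B S T \<infinity>"
    show "L (c *\<^sub>R p) = c * L p"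
    proof (rule eqI[OF scaleR_in_ncpolys[OF p] _ tendsto_mult_left[OF lim[OF p]]])
      show "\<forall>\<^sub>F n in sequentially. M n (c *\<^sub>R p) = c * M n p"
        using ev[OF p]
        by eventually_elim (use feasible_linear[OF M] in \<open>simp add: linear_on_def\<close>)
    qed
  qed
  moreover have "symmetric_on A B S T \<infinity> L"
    unfolding symmetric_on_def
  proof
    fix w assume w: "w \<in> words A B S T \<infinity>"
    then have rw: "rev w \<in> words A B S T \<infinity>"
      by (simp add: words_infinity lists_eq_set)
    have "\<forall>\<^sub>F n in sequentially. M n (mon w) = M n (mon (rev w))"
      using ev_mon[OF w]
      by eventually_elim (use M in \<open>simp add: xi_feasible_def symmetric_on_def\<close>)
    then show "L (mon w) = L (star (mon w))"
      using eqI[of "mon w" "\<lambda>n. M n (mon (rev w))"] lim[of "mon (rev w)"] w rw by simp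
  qed
  moreover have "tracial_on A B S T \<infinity> L"
    unfolding tracial_on_def
  proof (intro allI impI)
    fix w w' assume w: "w @ w' \<in> words A B S T \<infinity>"
    then have rw: "w' @ w \<in> words A B S T \<infinity>"
      by (simp add: words_infinity)
    have "\<forall>\<^sub>F n in sequentially. M n (mon (w @ w')) = M n (mon (w' @ w))"
      using ev_mon[OF w]
      by eventually_elim (use M in \<open>simp add: xi_feasible_def tracial_on_def\<close>)
    then show "L (mon (w @ w')) = L (mon (w' @ w))"
      using eqI[of "mon (w @ w')" "\<lambda>n. M n (mon (w' @ w))"] lim[of "mon (w' @ w)"] w rw by simp
  qed
  moreover have "L z_var = 1"
    using M Z by (intro eqI[of _ "\<lambda>_. 1"]) (auto simp: words_infinity xi_feasible_def)
  moreover have "L (x_var a s * y_var b t * z_var) = P (a, b, s, t)"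
    if i: "(a, b, s, t) \<in> A \<times> B \<times> S \<times> T" for a b s t
  proof (rule eqI[OF _ _ tendsto_const])
    show "x_var a s * y_var b t * z_var \<in> ncpolys A B S T \<infinity>"
      using i by (simp add: words_infinity symbols_def)
    show "\<forall>\<^sub>F n in sequentially. M n (x_var a s * y_var b t * z_var) = P (a, b, s, t)"
    \<comment> \<open>The correlation constraint is imposed from level 2 on, and
      \<open>n \<le> k n\<close>.\<close>
    proof (rule eventually_sequentiallyI[of 2])
      fix n :: nat assume "2 \<le> n"
      then have "2 \<le> enat (k n)"
        using seq_suble[OF k, of n] by (simp add: numeral_eq_enat)
      then show "M n (x_var a s * y_var b t * z_var) = P (a, b, s, t)"
        using M[of n] i by (auto simp: xi_feasible_def)
    qed
  qed
  moreover have "0 \<le> L p" if "p \<in> quad_module A B S T \<infinity> (gens A B S T)" for p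
  proof -
    \<comment> \<open>Since \<open>?C\<close> is a convex cone, checking the generators of the
      quadratic module is enough.\<close>
    let ?C = "{p \<in> ncpolys A B S T \<infinity>. 0 \<le> L p}"
    let ?Q = "\<lambda>m. {star p * g * p |p g. p \<in> ncpolys A B S T \<infinity> \<and> g \<in> gens A B S T \<union> {1} \<and>
        star p * g * p \<in> ncpolys A B S T m}"
    have "L 0 = 0"
      using linear_on_diff[OF \<open>linear_on _ L\<close> zero_in_ncpolys zero_in_ncpolys] by simp
    then have "convex_cone ?C"
      unfolding convex_cone_iff using \<open>linear_on _ L\<close>
      by (auto simp: linear_on_def add_in_ncpolys scaleR_in_ncpolys)
    moreover have "?Q \<infinity> \<subseteq> ?C"
    proof
      fix q assume q: "q \<in> ?Q \<infinity>"
      then have qn: "q \<in> ncpolys A B S T \<infinity>"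
        by blast
      have "\<forall>\<^sub>F n in sequentially. 0 \<le> M n q"
        using ev[OF qn]
      proof eventually_elim
        case (elim n)
        then have "q \<in> ?Q (2 * enat (k n))"
          using q by blast
        then have "q \<in> quad_module A B S T (2 * enat (k n)) (gens A B S T)"
          unfolding quad_module_def by (rule hull_inc)
        then show ?case
          using M[of n] by (simp add: xi_feasible_def)
      qed
      then show "q \<in> ?C"
        using tendsto_lowerbound[OF lim[OF qn]] qn by simp
    qed
    ultimately have "convex_cone hull ?Q \<infinity> \<subseteq> ?C"
      by (intro hull_minimal)
    then show ?thesis
      using that unfolding quad_module_def by blast
  qed
  moreover have "L q = 0"
    if q: "q \<in> trunc_ideal A B S T \<infinity> (hrels A B S T \<union> rrels A B S T \<infinity>)" for q
  proof -
    obtain p h where q_def: "q = p * h" and p: "p \<in> ncpolys A B S T \<infinity>"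
      and h: "h \<in> hrels A B S T \<union> rrels A B S T \<infinity>" and qn: "q \<in> ncpolys A B S T \<infinity>"
      using q by (auto simp: trunc_ideal_def)
    \<comment> \<open>The set \<open>rrels\<close> grows with the level, and a single relation has
      finite degree, so it enters at some finite level.\<close>
    have "\<forall>\<^sub>F n in sequentially. h \<in> hrels A B S T \<union> rrels A B S T (enat (k n))"
    proof (cases "h \<in> hrels A B S T")
      case False
      then obtain u v where uv: "u \<in> words A B S T \<infinity>" "v \<in> words A B S T \<infinity>"
        and "h = z_var * mon u * z_var * mon v * z_var - z_var * mon v * z_var * mon u * z_var"
        and "z_var * mon u * z_var * mon v * z_var \<in> ncpolys A B S T \<infinity>"
        using h False unfolding rrels_def two_times_infinity by blast
      from ev[OF this(4)] show ?thesis
        by eventually_elim (use uv \<open>h = _\<close> in \<open>unfold rrels_def, blast\<close>)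
    qed simp
    with ev[OF qn] have "\<forall>\<^sub>F n in sequentially. M n q = 0"
    proof eventually_elim
      case (elim n)
      then have "q \<in> trunc_ideal A B S T (2 * enat (k n)) (hrels A B S T \<union> rrels A B S T (enat (k n)))"
        using p q_def unfolding trunc_ideal_def by blast
      then show ?case
        using M[of n] by (simp add: xi_feasible_def)
    qed
    then show ?thesis
      by (rule eqI[OF qn _ tendsto_const])
  qed
  ultimately show ?thesis
    by (simp add: xi_feasible_def two_times_infinity)
qed

text \<open>Sequential compactness of a product of countably many bounded intervals, one for each
  word.\<close>

lemma feasible_infinity_exists:
  assumes fin: "finite A" "finite B" "finite S" "finite T"
    and M: "\<And>n. M n \<in> xi_feasible A B S T P (enat n)" and c: "\<And>n. M n 1 \<le> c"
  shows "\<exists>L \<in> xi_feasible A B S T P \<infinity>. L 1 \<le> c"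
proof -
  \<comment> \<open>The uniform bound on \<open>M n (mon w)\<close> is available only from
    \<open>n = length w + 1\<close> on. The default \<open>0\<close> alters finitely many terms for
    each \<open>w\<close>, hence no limit.\<close>
  define f where "f n w = (if length w + 1 \<le> n then M n (mon w) else 0)" for n w
  have fin_symbols: "finite (symbols A B S T)"
  proof -
    have "symbols A B S T = (\<lambda>(a, s). X a s) ` (A \<times> S) \<union> (\<lambda>(b, t). Y b t) ` (B \<times> T) \<union> {Z}"
      by (auto simp: symbols_def)
    then show ?thesis
      using fin by simp
  qed
  \<comment> \<open>The maximum with \<open>0\<close> covers the default value whatever the sign of
    \<open>c\<close>.\<close>
  have bound: "norm (f n w) \<le> max c 0" if "w \<in> lists (symbols A B S T)" for n w
    using feasible_bounded[OF fin(1,2) M that, of n] c[of n] by (auto simp: f_def)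
  have "countable (lists (symbols A B S T))"
    using fin_symbols by (intro countable_lists countable_finite)
  then obtain k where k: "strict_mono k"
    and conv: "\<And>w. w \<in> lists (symbols A B S T) \<Longrightarrow> \<exists>l. (\<lambda>n. f (k n) w) \<longlonglongrightarrow> l"
    \<comment> \<open>Diagonal extraction: a single subsequence \<open>k\<close> works for all
      words.\<close>
    using function_convergent_subsequence[of "lists (symbols A B S T)" f "max c 0"] bound by metis
  have kn: "n \<le> k n" for n
    using seq_suble[OF k] .
  obtain l where l: "\<And>w. w \<in> lists (symbols A B S T) \<Longrightarrow> (\<lambda>n. M (k n) (mon w)) \<longlonglongrightarrow> l w"
  proof -
    have "\<exists>l. (\<lambda>n. M (k n) (mon w)) \<longlonglongrightarrow> l" if w: "w \<in> lists (symbols A B S T)" for w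
    proof -
      obtain l where "(\<lambda>n. f (k n) w) \<longlonglongrightarrow> l"
        using conv[OF w] by blast
      moreover have "\<forall>\<^sub>F n in sequentially. f (k n) w = M (k n) (mon w)"
        by (rule eventually_sequentiallyI[of "length w + 1"]) (use kn order_trans in \<open>fastforce simp: f_def\<close>)
      ultimately show ?thesis
        using tendsto_cong[of "\<lambda>n. f (k n) w" "\<lambda>n. M (k n) (mon w)"] by blast
    qed
    then show thesis
      using that by metis
  qed
  \<comment> \<open>The linear extension of the limits \<open>l\<close> from words to
    polynomials.\<close>
  define L where "L p = (\<Sum>w\<in>Poly_Mapping.keys p. Poly_Mapping.lookup p w * l w)" for p
  have lim: "(\<lambda>n. M (k n) p) \<longlonglongrightarrow> L p" if p: "p \<in> ncpolys A B S T \<infinity>" for p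
  proof -
    obtain N where N: "\<forall>n\<ge>N. p \<in> ncpolys A B S T (2 * enat n)"
      using ncpolys_infinity_degree[OF p] by blast
    have "\<forall>\<^sub>F n in sequentially. (\<Sum>w\<in>Poly_Mapping.keys p. Poly_Mapping.lookup p w * M (k n) (mon w)) = M (k n) p"
    proof (rule eventually_sequentiallyI[of N])
      fix n assume "N \<le> n"
      then have "p \<in> ncpolys A B S T (2 * enat (k n))"
        using N kn[of n] by auto
      then show "(\<Sum>w\<in>Poly_Mapping.keys p. Poly_Mapping.lookup p w * M (k n) (mon w)) = M (k n) p"
        using linear_on_ncpolys_expand[OF feasible_linear[OF M]] by metis
    qed
    moreover have "(\<lambda>n. \<Sum>w\<in>Poly_Mapping.keys p. Poly_Mapping.lookup p w * M (k n) (mon w)) \<longlonglongrightarrow> L p"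
      unfolding L_def using p
      by (intro tendsto_sum tendsto_mult_left l) (auto simp: ncpolys_def words_infinity)
    ultimately show ?thesis
      by (rule Lim_transform_eventually[rotated])
  qed
  have "L \<in> xi_feasible A B S T P \<infinity>"
    using feasible_limit[OF k M lim] .
  moreover have "L 1 \<le> c"
  proof (rule LIMSEQ_le_const2)
    show "(\<lambda>n. M (k n) 1) \<longlonglongrightarrow> L 1"
      by (rule lim) (simp flip: mon_Nil add: words_infinity)
  qed (use c in blast)
  ultimately show ?thesis
    by blast
qed

theorem proposition2p9:
  fixes A :: "'a set" and B :: "'b set" and S :: "'s set" and T :: "'t set"
    and P :: "'a \<times> 'b \<times> 's \<times> 't \<Rightarrow> real"
  assumes "finite A" and "finite B" and "finite S" and "finite T"
    and "P \<in> Cq A B S T"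
  shows "(\<lambda>r::nat. xi_q A B S T P (enat r)) \<longlonglongrightarrow> xi_q A B S T P \<infinity>"
proof -
  have "xi_q A B S T P \<infinity> \<le> (SUP r. xi_q A B S T P (enat r))"
  proof (rule ccontr)
    assume "\<not> ?thesis"
    \<comment> \<open>A real \<open>c\<close> strictly between the two values: strictness on the
      left yields feasible functionals with \<open>L 1 \<le> c\<close> at every level, even if the
      value on the right is \<open>\<infinity>\<close>.\<close>
    then obtain c where c: "(SUP r. xi_q A B S T P (enat r)) < ereal c" "ereal c < xi_q A B S T P \<infinity>"
      using ereal_dense2 by (metis not_le)
    have "\<exists>L \<in> xi_feasible A B S T P (enat n). L 1 \<le> c" for n
    proof -
      have "xi_q A B S T P (enat n) < ereal c"
        using c(1) by (rule order_le_less_trans[OF SUP_upper, rotated]) simp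
      then show ?thesis
        unfolding xi_q_def INF_less_iff by (auto intro: less_imp_le)
    qed
    then obtain L where "L \<in> xi_feasible A B S T P \<infinity>" "L 1 \<le> c"
      using feasible_infinity_exists[OF assms(1-4)] by metis
    then have "xi_q A B S T P \<infinity> \<le> ereal c"
      unfolding xi_q_def by (intro INF_lower2) auto
    then show False
      using c(2) by simp
  qed
  moreover have "(SUP r. xi_q A B S T P (enat r)) \<le> xi_q A B S T P \<infinity>"
    by (intro SUP_least xi_q_mono) simp
  \<comment> \<open>A monotone sequence of extended reals converges to its supremum, so the two
    inequalities identify the limit.\<close>
  moreover have "(\<lambda>r. xi_q A B S T P (enat r)) \<longlonglongrightarrow> (SUP r. xi_q A B S T P (enat r))"
    by (intro LIMSEQ_SUP incseq_SucI xi_q_mono) simp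
  ultimately show ?thesis
    by (simp add: antisym)
qed

end
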